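(* Let $\sigma$ be a finite relational signature and $\mathcal C$ a class of finite $\sigma$-structures. Then $\mathcal C$ is bounded and has all restricted dualities if and only if for every integer $t$ there is an integer $N(t)$ such that for every $\mathbf A\in\mathcal C$ there exists a $\sigma$-structure $\mathbf A_t$ with: (i) $|A_t|\le N(t)$; (ii) $\mathbf A\to\mathbf A_t$; (iii) every substructure $\mathbf F$ of $\mathbf A_t$ with $|F|<t$ satisfies $\mathbf F\to\mathbf A$.
   Context: A $\sigma$-structure $\mathbf A$ has a universe $A$ and for each $R\in\sigma$ of arity $r$ a relation $R^{\mathbf A}\subseteq A^r$; its order is $|A|$. $\mathbf B$ is a substructure of $\mathbf A$ if $B\subseteq A$ and $R^{\mathbf B}\subseteq R^{\mathbf A}$ for all $R$. A homomorphism $\mathbf A\to\mathbf B$ is a map $f:A\to B$ with $(x_1,\dots,x_k)\in R^{\mathbf A}\Rightarrow (f(x_1),\dots,f(x_k))\in R^{\mathbf B}$ for all $R\in\sigma$. A structure is connected if its Gaifman graph (vertices $A$, with $x\neq y$ adjacent iff they occur together in some tuple of some relation of arity $\ge 2$) is connected. $\mathcal C$ is bounded if there is a finite $\sigma$-structure $\mathbf Z$ with $\mathbf A\to\mathbf Z$ for all $\mathbf A\in\mathcal C$. $\mathcal C$ has all restricted dualities if for every non-empty connected finite $\sigma$-structure $\mathbf F$ there is a $\sigma$-structure $\mathbf D$ with $\mathbf F\nrightarrow\mathbf D$ such that for all $\mathbf A\in\mathcal C$: $\mathbf F\to\mathbf A$ iff $\mathbf A\nrightarrow\mathbf D$.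
   Formalization: Relation symbols are required to have positive arity, and each restricted dual D is required to be a finite σ-structure; with nullary symbols or with infinite duals the stated equivalence fails. *)

theory Defs
  imports Main "HOL-Library.FuncSet"
begin

record 'r signature =
  symbols :: "'r set"
  arity :: "'r \<Rightarrow> nat"

text \<open>Relation symbols have positive arity. With nullary symbols a tuple would not belong to
  a single component of a disjoint union, and connectedness via the Gaifman graph would no longer
  control homomorphisms into disjoint unions.\<close>

definition relational_signature :: "'r signature \<Rightarrow> bool" where
  "relational_signature \<sigma> \<longleftrightarrow> (\<forall>R\<in>symbols \<sigma>. 1 \<le> arity \<sigma> R)"

text \<open>Tuples are lists. The values of \<open>rel\<close> outside the symbols of the signature are irrelevant.
  The universe may be empty.\<close>

record ('a, 'r) rel_structure =
  universe :: "'a set"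
  rel :: "'r \<Rightarrow> 'a list set"

definition is_structure :: "'r signature \<Rightarrow> ('a, 'r) rel_structure \<Rightarrow> bool" where
  "is_structure \<sigma> A \<longleftrightarrow>
     (\<forall>R\<in>symbols \<sigma>. rel A R \<subseteq> {xs. length xs = arity \<sigma> R \<and> set xs \<subseteq> universe A})"

definition finite_structure :: "'r signature \<Rightarrow> ('a, 'r) rel_structure \<Rightarrow> bool" where
  "finite_structure \<sigma> A \<longleftrightarrow> is_structure \<sigma> A \<and> finite (universe A)"

definition struct_order :: "('a, 'r) rel_structure \<Rightarrow> nat" where
  "struct_order A = card (universe A)"

definition substructure ::
    "'r signature \<Rightarrow> ('a, 'r) rel_structure \<Rightarrow> ('a, 'r) rel_structure \<Rightarrow> bool" where
  "substructure \<sigma> B A \<longleftrightarrow>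
     is_structure \<sigma> B \<and> universe B \<subseteq> universe A \<and> (\<forall>R\<in>symbols \<sigma>. rel B R \<subseteq> rel A R)"

definition homomorphism ::
    "'r signature \<Rightarrow> ('a, 'r) rel_structure \<Rightarrow> ('b, 'r) rel_structure \<Rightarrow> ('a \<Rightarrow> 'b) \<Rightarrow> bool" where
  "homomorphism \<sigma> A B f \<longleftrightarrow>
     f \<in> universe A \<rightarrow> universe B \<and> (\<forall>R\<in>symbols \<sigma>. \<forall>xs\<in>rel A R. map f xs \<in> rel B R)"

definition hom_to ::
    "'r signature \<Rightarrow> ('a, 'r) rel_structure \<Rightarrow> ('b, 'r) rel_structure \<Rightarrow> bool" where
  "hom_to \<sigma> A B \<longleftrightarrow> (\<exists>f. homomorphism \<sigma> A B f)"

definition gaifman_edges :: "'r signature \<Rightarrow> ('a, 'r) rel_structure \<Rightarrow> ('a \<times> 'a) set" where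
  "gaifman_edges \<sigma> A =
     {(x, y). x \<in> universe A \<and> y \<in> universe A \<and> x \<noteq> y \<and>
        (\<exists>R\<in>symbols \<sigma>. 2 \<le> arity \<sigma> R \<and> (\<exists>xs\<in>rel A R. x \<in> set xs \<and> y \<in> set xs))}"

definition connected_structure :: "'r signature \<Rightarrow> ('a, 'r) rel_structure \<Rightarrow> bool" where
  "connected_structure \<sigma> A \<longleftrightarrow>
     (\<forall>x\<in>universe A. \<forall>y\<in>universe A. (x, y) \<in> (gaifman_edges \<sigma> A)\<^sup>*)"

text \<open>Every finite structure is isomorphic to one whose universe is a set of natural numbers, so
  quantifying over finite structures on \<^typ>\<open>nat\<close> is no restriction.\<close>

definition bounded_class :: "'r signature \<Rightarrow> ('a, 'r) rel_structure set \<Rightarrow> bool" where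
  "bounded_class \<sigma> C \<longleftrightarrow>
     (\<exists>Z :: (nat, 'r) rel_structure. finite_structure \<sigma> Z \<and> (\<forall>A\<in>C. hom_to \<sigma> A Z))"

text \<open>The dual \<open>D\<close> has to be finite: if infinite duals were allowed, the disjoint union of all finite
  structures not admitting a homomorphism from \<open>F\<close> would be a dual of \<open>F\<close> for every class.\<close>

definition all_restricted_dualities ::
    "'r signature \<Rightarrow> ('a, 'r) rel_structure set \<Rightarrow> bool" where
  "all_restricted_dualities \<sigma> C \<longleftrightarrow>
     (\<forall>F :: (nat, 'r) rel_structure.
        finite_structure \<sigma> F \<and> universe F \<noteq> {} \<and> connected_structure \<sigma> F \<longrightarrow>
        (\<exists>D :: (nat, 'r) rel_structure.
           finite_structure \<sigma> D \<and> \<not> hom_to \<sigma> F D \<and>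
           (\<forall>A\<in>C. hom_to \<sigma> F A \<longleftrightarrow> \<not> hom_to \<sigma> A D)))"

end

theory Submission
  imports Defs
begin

text \<open>
  Up to isomorphism there are finitely many structures of a given order. Given restricted dualities,
  let \<open>A\<^sub>t\<close> be the product of the duals of all small connected \<open>F\<close> with no homomorphism to \<open>A\<close>: a
  component of a small substructure of \<open>A\<^sub>t\<close> maps to \<open>A\<close>, since otherwise it would map to its own
  dual. Conversely, for connected \<open>F\<close> put \<open>t = |F| + 1\<close>. If \<open>F\<close> does not map to \<open>A\<close>, it does not map
  to \<open>A\<^sub>t\<close> either, because of its image in \<open>A\<^sub>t\<close>; the dual of \<open>F\<close> is the disjoint union of all
  structures of order at most \<open>N(t)\<close> to which \<open>F\<close> does not map. Boundedness is automatic, as every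
  structure maps to a point carrying all loops.
\<close>

subsection \<open>Homomorphisms and normal forms\<close>

lemma hom_toI:
  assumes "\<And>x. x \<in> universe A \<Longrightarrow> f x \<in> universe B"
    and "\<And>R xs. R \<in> symbols \<sigma> \<Longrightarrow> xs \<in> rel A R \<Longrightarrow> map f xs \<in> rel B R"
  shows "hom_to \<sigma> A B"
  using assms unfolding hom_to_def homomorphism_def by blast

lemma hom_to_trans:
  assumes "hom_to \<sigma> A B" "hom_to \<sigma> B C"
  shows "hom_to \<sigma> A C"
proof -
  obtain f where f: "\<And>x. x \<in> universe A \<Longrightarrow> f x \<in> universe B"
    "\<And>R xs. R \<in> symbols \<sigma> \<Longrightarrow> xs \<in> rel A R \<Longrightarrow> map f xs \<in> rel B R"
    using assms(1) unfolding hom_to_def homomorphism_def by blast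
  obtain g where g: "\<And>x. x \<in> universe B \<Longrightarrow> g x \<in> universe C"
    "\<And>R xs. R \<in> symbols \<sigma> \<Longrightarrow> xs \<in> rel B R \<Longrightarrow> map g xs \<in> rel C R"
    using assms(2) unfolding hom_to_def homomorphism_def by blast
  show ?thesis
    by (rule hom_toI[where f = "g \<circ> f"]) (use f g in \<open>auto simp flip: map_map\<close>)
qed

lemma substructure_hom_to:
  assumes "substructure \<sigma> B A"
  shows "hom_to \<sigma> B A"
  using assms by (intro hom_toI[where f = "\<lambda>x. x"]) (auto simp: substructure_def)

lemma is_structureD:
  assumes "is_structure \<sigma> A" "R \<in> symbols \<sigma>" "xs \<in> rel A R"
  shows "length xs = arity \<sigma> R" "set xs \<subseteq> universe A"
  using assms unfolding is_structure_def by blast+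

text \<open>Serves both for transport along a bijection and for the image of a homomorphism.
  Relations off the signature are cleared so that such images can belong to
  \<open>structures_below\<close>.\<close>

definition image_structure ::
    "'r signature \<Rightarrow> ('a \<Rightarrow> 'b) \<Rightarrow> ('a, 'r) rel_structure \<Rightarrow> ('b, 'r) rel_structure" where
  "image_structure \<sigma> f A =
     \<lparr>universe = f ` universe A, rel = \<lambda>R. if R \<in> symbols \<sigma> then map f ` rel A R else {}\<rparr>"

lemma is_structure_image:
  assumes "is_structure \<sigma> A"
  shows "is_structure \<sigma> (image_structure \<sigma> f A)"
  using assms unfolding is_structure_def image_structure_def by fastforce

lemma hom_to_image: "hom_to \<sigma> A (image_structure \<sigma> f A)"
  by (rule hom_toI[where f = f]) (auto simp: image_structure_def)

lemma image_hom_to: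
  assumes "is_structure \<sigma> A" "inj_on f (universe A)"
  shows "hom_to \<sigma> (image_structure \<sigma> f A) A"
proof (rule hom_toI[where f = "inv_into (universe A) f"])
  fix R xs assume R: "R \<in> symbols \<sigma>" and "xs \<in> rel (image_structure \<sigma> f A) R"
  then obtain ys where ys: "ys \<in> rel A R" "xs = map f ys"
    by (auto simp: image_structure_def)
  have "map (inv_into (universe A) f) (map f ys) = ys"
    using is_structureD(2)[OF assms(1) R ys(1)] assms(2) by (auto intro!: map_idI)
  then show "map (inv_into (universe A) f) xs \<in> rel A R"
    using ys by simp
qed (auto simp: image_structure_def inv_into_into)

text \<open>Normal forms for structures of order at most \<open>n\<close>. Without the emptiness
  condition, arbitrary values of \<open>rel\<close> off the signature could make this set
  infinite.\<close>

definition structures_below :: "'r signature \<Rightarrow> nat \<Rightarrow> (nat, 'r) rel_structure set" where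
  "structures_below \<sigma> n =
     {S. is_structure \<sigma> S \<and> universe S \<subseteq> {..<n} \<and> (\<forall>R. R \<notin> symbols \<sigma> \<longrightarrow> rel S R = {})}"

text \<open>A member is determined by its universe and by \<open>rel\<close> restricted to the
  symbols, and each of these ranges over a finite set.\<close>

lemma finite_structures_below:
  assumes "finite (symbols \<sigma>)"
  shows "finite (structures_below \<sigma> n)"
proof -
  let ?g = "\<lambda>S :: (nat, 'a) rel_structure. (universe S, restrict (rel S) (symbols \<sigma>))"
  let ?T = "Pow {..<n} \<times>
    (\<Pi>\<^sub>E R\<in>symbols \<sigma>. Pow {xs. set xs \<subseteq> {..<n} \<and> length xs = arity \<sigma> R})"
  have "inj_on ?g (structures_below \<sigma> n)"
  proof (rule inj_onI)
    fix S T assume S: "S \<in> structures_below \<sigma> n" and T: "T \<in> structures_below \<sigma> n"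
      and eq: "?g S = ?g T"
    have "rel S R = rel T R" for R
      using S T eq by (cases "R \<in> symbols \<sigma>")
        (auto simp: structures_below_def dest: fun_cong[where x = R])
    then show "S = T"
      using eq by (intro rel_structure.equality) auto
  qed
  moreover have "?g ` structures_below \<sigma> n \<subseteq> ?T"
    unfolding structures_below_def is_structure_def by fastforce
  moreover have "finite ?T"
    using assms by (intro finite_cartesian_product finite_PiE)
      (auto simp: finite_lists_length_eq)
  ultimately show ?thesis
    by (meson finite_imageD finite_subset)
qed

lemma structures_below_finite_structure:
  "S \<in> structures_below \<sigma> n \<Longrightarrow> finite_structure \<sigma> S"
  by (auto simp: structures_below_def finite_structure_def dest: finite_subset)

text \<open>Numbering the universe gives an isomorphic copy. Only homomorphisms in both directions
  are recorded, because the existence of homomorphisms and duality are invariant under this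
  equivalence. It also brings structures on other types back to \<open>nat\<close>.\<close>

lemma hom_equivalent_below:
  fixes A :: "('a, 'r) rel_structure"
  assumes "finite_structure \<sigma> A" "struct_order A \<le> n"
  shows "\<exists>S\<in>structures_below \<sigma> n. hom_to \<sigma> A S \<and> hom_to \<sigma> S A"
proof -
  have A: "is_structure \<sigma> A" "finite (universe A)"
    using assms(1) by (auto simp: finite_structure_def)
  obtain f where f: "bij_betw f (universe A) {..<card (universe A)}"
    using ex_bij_betw_finite_nat[OF A(2)] by (auto simp: atLeast0LessThan)
  have "image_structure \<sigma> f A \<in> structures_below \<sigma> n"
    using is_structure_image[OF A(1), of f] f assms(2)
    by (auto simp: structures_below_def image_structure_def bij_betw_def struct_order_def)
  then show ?thesis
    using hom_to_image[of \<sigma> A f] image_hom_to[OF A(1), of f] f by (auto simp: bij_betw_def)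
qed

subsection \<open>Products and disjoint unions\<close>

text \<open>The direct product, characterised by its universal property: coordinate projections one
  way, tupling of homomorphisms the other. For empty \<open>E\<close> it is a single point carrying
  all loops, to which every structure maps.\<close>

lemma finite_product_exists:
  fixes E :: "(nat, 'r) rel_structure set"
  assumes "finite E" "\<forall>D\<in>E. finite_structure \<sigma> D"
  shows "\<exists>P :: (nat, 'r) rel_structure. finite_structure \<sigma> P \<and> (\<forall>D\<in>E. hom_to \<sigma> P D) \<and>
    (\<forall>A :: ('a, 'r) rel_structure. is_structure \<sigma> A \<longrightarrow> (\<forall>D\<in>E. hom_to \<sigma> A D) \<longrightarrow> hom_to \<sigma> A P)"
proof -
  let ?U = "\<Pi>\<^sub>E D\<in>E. universe D"
  define Q where "Q = \<lparr>universe = ?U, rel = \<lambda>R. {xs. length xs = arity \<sigma> R \<and> set xs \<subseteq> ?U \<and>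
    (\<forall>D\<in>E. map (\<lambda>g. g D) xs \<in> rel D R)}\<rparr>"
  have fin: "finite_structure \<sigma> Q"
    using assms by (auto simp: Q_def finite_structure_def is_structure_def intro!: finite_PiE)
  have proj: "hom_to \<sigma> Q D" if "D \<in> E" for D
    using that by (intro hom_toI[where f = "\<lambda>g. g D"]) (auto simp: Q_def)
  have pair: "hom_to \<sigma> A Q"
    if A: "is_structure \<sigma> A" and homs: "\<forall>D\<in>E. hom_to \<sigma> A D" for A :: "('a, 'r) rel_structure"
  proof -
    from homs obtain h where h: "\<forall>D\<in>E. homomorphism \<sigma> A D (h D)"
      unfolding hom_to_def by metis
    show ?thesis
    proof (rule hom_toI[where f = "\<lambda>x. \<lambda>D\<in>E. h D x"])
      show U: "(\<lambda>D\<in>E. h D x) \<in> universe Q" if "x \<in> universe A" for x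
        using h that by (auto simp: Q_def homomorphism_def)
      fix R xs assume R: "R \<in> symbols \<sigma>" "xs \<in> rel A R"
      have "map (\<lambda>g. g D) (map (\<lambda>x. \<lambda>D\<in>E. h D x) xs) \<in> rel D R" if "D \<in> E" for D
        using h R that by (auto simp: homomorphism_def comp_def)
      then show "map (\<lambda>x. \<lambda>D\<in>E. h D x) xs \<in> rel Q R"
        using U is_structureD[OF A R] unfolding Q_def
        by (simp add: image_subset_iff subset_eq)
    qed
  qed
  \<comment> \<open>The elements of \<open>Q\<close> are functions on \<open>E\<close>; a normal
    form of \<open>Q\<close> has natural numbers as elements and keeps the universal
    property.\<close>
  obtain P where "P \<in> structures_below \<sigma> (struct_order Q)" "hom_to \<sigma> Q P" "hom_to \<sigma> P Q"
    using hom_equivalent_below[OF fin order_refl] by blast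
  with proj pair show ?thesis
    by (intro exI[of _ P] conjI) (blast intro: hom_to_trans structures_below_finite_structure)+
qed

text \<open>Elements are tagged with their summand. A homomorphism from a connected structure cannot
  change the tag along a Gaifman edge, so it stays inside one summand; non-emptiness of
  \<open>F\<close> provides that summand.\<close>

lemma finite_disjoint_union_exists:
  fixes E :: "(nat, 'r) rel_structure set"
  assumes sig: "relational_signature \<sigma>"
    and "finite E" "\<forall>S\<in>E. finite_structure \<sigma> S"
  shows "\<exists>D :: (nat, 'r) rel_structure. finite_structure \<sigma> D \<and> (\<forall>S\<in>E. hom_to \<sigma> S D) \<and>
    (\<forall>F :: ('a, 'r) rel_structure. is_structure \<sigma> F \<longrightarrow> connected_structure \<sigma> F \<longrightarrow>
       universe F \<noteq> {} \<longrightarrow> hom_to \<sigma> F D \<longrightarrow> (\<exists>S\<in>E. hom_to \<sigma> F S))"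
proof -
  define Q where "Q = \<lparr>universe = Sigma E universe,
    rel = \<lambda>R. \<Union>S\<in>E. map (Pair S) ` rel S R\<rparr>"
  have "is_structure \<sigma> Q"
    using assms(3) unfolding Q_def is_structure_def finite_structure_def by fastforce
  then have fin: "finite_structure \<sigma> Q"
    using assms(2,3) by (auto simp: Q_def finite_structure_def)
  have incl: "hom_to \<sigma> S Q" if "S \<in> E" for S
    using that by (intro hom_toI[where f = "Pair S"]) (auto simp: Q_def)
  have split: "\<exists>S\<in>E. hom_to \<sigma> F S"
    if F: "is_structure \<sigma> F" and conn: "connected_structure \<sigma> F" and ne: "universe F \<noteq> {}"
      and hom: "hom_to \<sigma> F Q" for F :: "('a, 'r) rel_structure"
  proof -
    obtain h where hU: "\<And>x. x \<in> universe F \<Longrightarrow> h x \<in> universe Q"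
      and hR: "\<And>R xs. R \<in> symbols \<sigma> \<Longrightarrow> xs \<in> rel F R \<Longrightarrow> map h xs \<in> rel Q R"
      using hom unfolding hom_to_def homomorphism_def by blast
    have tuple: "\<exists>S\<in>E. (\<forall>x\<in>set xs. fst (h x) = S) \<and> map (snd \<circ> h) xs \<in> rel S R"
      if R: "R \<in> symbols \<sigma>" "xs \<in> rel F R" for R xs
    proof -
      obtain S ys where S: "S \<in> E" "ys \<in> rel S R" "map h xs = map (Pair S) ys"
        using hR[OF R] by (auto simp: Q_def)
      have "map fst (map h xs) = map (\<lambda>_. S) ys" "map snd (map h xs) = ys"
        unfolding S(3) by (auto simp: comp_def)
      then have "map (fst \<circ> h) xs = replicate (length ys) S" "map (snd \<circ> h) xs = ys"
        by (simp_all add: map_replicate_const)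
      moreover from this(1) have "(fst \<circ> h) ` set xs \<subseteq> {S}"
        unfolding list.set_map[symmetric] by (simp add: set_replicate_conv_if)
      ultimately show ?thesis
        using S by (intro bexI[of _ S]) auto
    qed
    obtain x0 where x0: "x0 \<in> universe F"
      using ne by blast
    \<comment> \<open>Adjacent vertices occur in a common tuple, whose image has a single tag by
      \<open>tuple\<close>; induction along a Gaifman path from \<open>x0\<close> spreads this to
      all of \<open>F\<close>.\<close>
    have const: "fst (h y) = fst (h x0)" if "y \<in> universe F" for y
    proof -
      have "(x0, y) \<in> (gaifman_edges \<sigma> F)\<^sup>*"
        using conn x0 that by (auto simp: connected_structure_def)
      then show ?thesis
        by induction (use tuple in \<open>fastforce simp: gaifman_edges_def\<close>)+
    qed
    let ?S = "fst (h x0)"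
    have "?S \<in> E"
      using hU[OF x0] by (auto simp: Q_def)
    moreover have "hom_to \<sigma> F ?S"
    proof (rule hom_toI[where f = "snd \<circ> h"])
      show "(snd \<circ> h) x \<in> universe ?S" if "x \<in> universe F" for x
        using hU[OF that] const[OF that] by (auto simp: Q_def)
      fix R xs assume R: "R \<in> symbols \<sigma>" "xs \<in> rel F R"
      \<comment> \<open>Positive arity gives the tuple an entry, and the tag of that entry
        identifies the summand supplied by \<open>tuple\<close> with \<open>?S\<close>. An empty
        tuple could come from any summand.\<close>
      have "set xs \<subseteq> universe F" "xs \<noteq> []"
        using is_structureD[OF F R] sig R(1) by (auto simp: relational_signature_def)
      moreover obtain x where "x \<in> set xs"
        using \<open>xs \<noteq> []\<close> by (meson list.set_sel(1))
      ultimately show "map (snd \<circ> h) xs \<in> rel ?S R"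
        using tuple[OF R] const by (metis subsetD)
    qed
    ultimately show ?thesis ..
  qed
  obtain D where "D \<in> structures_below \<sigma> (struct_order Q)" "hom_to \<sigma> Q D" "hom_to \<sigma> D Q"
    using hom_equivalent_below[OF fin order_refl] by blast
  with incl split show ?thesis
    by (intro exI[of _ D] conjI) (blast intro: hom_to_trans structures_below_finite_structure)+
qed

subsection \<open>Connected components\<close>

definition component ::
    "'r signature \<Rightarrow> ('a, 'r) rel_structure \<Rightarrow> 'a \<Rightarrow> ('a, 'r) rel_structure" where
  "component \<sigma> A x = (let K = {y \<in> universe A. (x, y) \<in> (gaifman_edges \<sigma> A)\<^sup>*} in
     \<lparr>universe = K, rel = \<lambda>R. {xs \<in> rel A R. set xs \<subseteq> K}\<rparr>)"

lemma universe_component: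
  "universe (component \<sigma> A x) = {y \<in> universe A. (x, y) \<in> (gaifman_edges \<sigma> A)\<^sup>*}"
  by (simp add: component_def Let_def)

lemma rel_component:
  "rel (component \<sigma> A x) R = {xs \<in> rel A R. set xs \<subseteq> universe (component \<sigma> A x)}"
  by (simp add: component_def Let_def)

lemma substructure_component:
  assumes "is_structure \<sigma> A"
  shows "substructure \<sigma> (component \<sigma> A x) A"
  using assms by (auto simp: substructure_def is_structure_def universe_component rel_component)

lemma sym_gaifman_edges: "sym (gaifman_edges \<sigma> A)"
  by (auto simp: sym_def gaifman_edges_def)

text \<open>Two distinct entries force length, hence arity, at least 2, so they are joined by an
  edge; unary symbols never produce distinct entries.\<close>

lemma tuple_gaifman_connected:
  assumes "is_structure \<sigma> A" "R \<in> symbols \<sigma>" "xs \<in> rel A R" "x \<in> set xs" "y \<in> set xs"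
  shows "(x, y) \<in> (gaifman_edges \<sigma> A)\<^sup>*"
proof (cases "x = y")
  case False
  have "card {x, y} \<le> length xs"
    using assms(4,5) by (meson card_length card_mono empty_subsetI finite_set insert_subset
        order_trans)
  then have "2 \<le> arity \<sigma> R"
    using False is_structureD(1)[OF assms(1-3)] by simp
  then have "(x, y) \<in> gaifman_edges \<sigma> A"
    using False assms is_structureD(2)[OF assms(1-3)] by (auto simp: gaifman_edges_def)
  then show ?thesis by blast
qed simp

text \<open>A tuple witnessing an edge at a vertex reachable from \<open>x\<close> lies entirely
  inside the component. Paths from \<open>x\<close> therefore survive in the component, and by
  symmetry any two vertices are joined through \<open>x\<close>.\<close>

lemma connected_component:
  assumes A: "is_structure \<sigma> A"
  shows "connected_structure \<sigma> (component \<sigma> A x)"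
proof -
  let ?G = "gaifman_edges \<sigma> A" and ?H = "gaifman_edges \<sigma> (component \<sigma> A x)"
  have edge: "(y, z) \<in> ?H" if xy: "(x, y) \<in> ?G\<^sup>*" and yzG: "(y, z) \<in> ?G" for y z
  proof -
    obtain R xs where R: "R \<in> symbols \<sigma>" "2 \<le> arity \<sigma> R" "xs \<in> rel A R" "y \<in> set xs" "z \<in> set xs"
      and yz: "y \<noteq> z"
      using yzG by (auto simp: gaifman_edges_def)
    have "set xs \<subseteq> universe (component \<sigma> A x)"
      using tuple_gaifman_connected[OF A R(1,3,4)] is_structureD(2)[OF A R(1,3)] xy
      by (auto simp: universe_component intro: rtrancl_trans)
    then show ?thesis
      using R yz by (auto simp: gaifman_edges_def rel_component)
  qed
  have reach: "(x, y) \<in> ?H\<^sup>*" if "(x, y) \<in> ?G\<^sup>*" for y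
    using that
  proof induction
    case (step y z)
    then show ?case
      using edge by (meson rtrancl.rtrancl_into_rtrancl)
  qed simp
  show ?thesis
    unfolding connected_structure_def
  proof (intro ballI)
    fix y z assume "y \<in> universe (component \<sigma> A x)" "z \<in> universe (component \<sigma> A x)"
    then have "(x, y) \<in> ?H\<^sup>*" "(x, z) \<in> ?H\<^sup>*"
      using reach by (auto simp: universe_component)
    then show "(y, z) \<in> ?H\<^sup>*"
      by (meson rtrancl_trans sym_gaifman_edges sym_rtrancl symD)
  qed
qed

text \<open>Homomorphisms chosen separately on the components glue together, because each tuple is
  non-empty and lies in exactly one component.\<close>

lemma hom_to_if_components:
  fixes A :: "('b, 'a) rel_structure"
  assumes sig: "relational_signature \<sigma>" and A: "is_structure \<sigma> A"
    and comps: "\<And>x. x \<in> universe A \<Longrightarrow> hom_to \<sigma> (component \<sigma> A x) B"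
  shows "hom_to \<sigma> A B"
proof -
  \<comment> \<open>The choice is indexed by the component itself and not by its base point, so by
    \<open>same\<close> all points of one component use the same homomorphism.\<close>
  define h where "h K = (SOME f. homomorphism \<sigma> K B f)" for K :: "('b, 'a) rel_structure"
  have h: "homomorphism \<sigma> (component \<sigma> A x) B (h (component \<sigma> A x))" if "x \<in> universe A" for x
    using comps[OF that] unfolding h_def hom_to_def by (rule someI_ex)
  have same: "component \<sigma> A x = component \<sigma> A y" if "(x, y) \<in> (gaifman_edges \<sigma> A)\<^sup>*" for x y
  proof -
    have "(y, x) \<in> (gaifman_edges \<sigma> A)\<^sup>*"
      using that by (meson sym_gaifman_edges sym_rtrancl symD)
    with that have "(x, z) \<in> (gaifman_edges \<sigma> A)\<^sup>* \<longleftrightarrow> (y, z) \<in> (gaifman_edges \<sigma> A)\<^sup>*" for z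
      by (meson rtrancl_trans)
    then show ?thesis
      by (simp add: component_def)
  qed
  show ?thesis
  proof (rule hom_toI[where f = "\<lambda>x. h (component \<sigma> A x) x"])
    show "h (component \<sigma> A x) x \<in> universe B" if "x \<in> universe A" for x
      using h[OF that] that by (auto simp: homomorphism_def universe_component)
    fix R xs assume R: "R \<in> symbols \<sigma>" "xs \<in> rel A R"
    have "xs \<noteq> []"
      using is_structureD[OF A R] sig R(1) by (auto simp: relational_signature_def)
    then obtain x where x: "x \<in> set xs"
      by (meson list.set_sel(1))
    let ?K = "component \<sigma> A x"
    have conn: "(x, y) \<in> (gaifman_edges \<sigma> A)\<^sup>*" if "y \<in> set xs" for y
      using tuple_gaifman_connected[OF A R x that] .
    have xA: "x \<in> universe A" and "xs \<in> rel ?K R"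
      using is_structureD(2)[OF A R] R(2) x conn by (auto simp: rel_component universe_component)
    then have "map (h ?K) xs \<in> rel B R"
      using h[OF xA] R(1) by (auto simp: homomorphism_def)
    moreover have "map (\<lambda>y. h (component \<sigma> A y) y) xs = map (h ?K) xs"
      using same[OF conn] by (intro map_cong) simp_all
    ultimately show "map (\<lambda>y. h (component \<sigma> A y) y) xs \<in> rel B R"
      by (simp only:)
  qed
qed

subsection \<open>Restricted duals\<close>

definition is_dual ::
    "'r signature \<Rightarrow> ('a, 'r) rel_structure set \<Rightarrow> ('b, 'r) rel_structure \<Rightarrow>
      (nat, 'r) rel_structure \<Rightarrow> bool" where
  "is_dual \<sigma> C F D \<longleftrightarrow> finite_structure \<sigma> D \<and> \<not> hom_to \<sigma> F D \<and>
     (\<forall>A\<in>C. hom_to \<sigma> F A \<longleftrightarrow> \<not> hom_to \<sigma> A D)"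

text \<open>Allows a dual of a component to be replaced by the dual chosen for its normal
  form.\<close>

lemma is_dual_hom_equivalent:
  assumes "is_dual \<sigma> C F D" "hom_to \<sigma> F G" "hom_to \<sigma> G F"
  shows "is_dual \<sigma> C G D"
  using assms unfolding is_dual_def by (meson hom_to_trans)

lemma bounded_class_trivial:
  assumes "\<forall>A\<in>C. finite_structure \<sigma> A"
  shows "bounded_class \<sigma> C"
proof -
  define Z :: "(nat, 'b) rel_structure" where
    "Z = \<lparr>universe = {0}, rel = \<lambda>R. {replicate (arity \<sigma> R) 0}\<rparr>"
  have "finite_structure \<sigma> Z"
    by (auto simp: Z_def finite_structure_def is_structure_def)
  moreover have "hom_to \<sigma> A Z" if "A \<in> C" for A
    using assms that by (intro hom_toI[where f = "\<lambda>_. 0"])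
      (auto simp: Z_def finite_structure_def is_structureD(1) map_replicate_const)
  ultimately show ?thesis
    unfolding bounded_class_def by blast
qed

text \<open>The approximation of \<open>A\<close> depends only on which of finitely many normal
  forms fail to map to \<open>A\<close>; this makes the bound on its order uniform over
  \<open>C\<close>.\<close>

lemma approximation_if_dualities:
  fixes \<sigma> :: "'r signature" and C :: "('a, 'r) rel_structure set"
  assumes sig: "relational_signature \<sigma>" and fin: "finite (symbols \<sigma>)"
    and C: "\<forall>A\<in>C. finite_structure \<sigma> A"
    and dual: "all_restricted_dualities \<sigma> C"
  shows "\<exists>N. \<forall>A\<in>C. \<exists>P :: (nat, 'r) rel_structure.
    finite_structure \<sigma> P \<and> struct_order P \<le> N \<and> hom_to \<sigma> A P \<and>
    (\<forall>F. substructure \<sigma> F P \<and> struct_order F \<le> n \<longrightarrow> hom_to \<sigma> F A)"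
proof -
  \<comment> \<open>Having a dual replaces connectedness as the selection criterion: it passes
    through homomorphic equivalence, whereas connectedness of a normal form would need a separate
    argument.\<close>
  define \<F> where "\<F> = {F \<in> structures_below \<sigma> n. \<exists>D. is_dual \<sigma> C F D}"
  have fin\<F>: "finite \<F>"
    unfolding \<F>_def using finite_structures_below[OF fin] by simp
  have "\<forall>F\<in>\<F>. \<exists>D. is_dual \<sigma> C F D"
    by (simp add: \<F>_def)
  then obtain d where d: "\<And>F. F \<in> \<F> \<Longrightarrow> is_dual \<sigma> C F (d F)"
    by metis
  \<comment> \<open>A product of duals is built for every subfamily before any \<open>A\<close> is
    fixed, so that \<open>N\<close> can be chosen first.\<close>
  have "\<exists>P :: (nat, 'r) rel_structure. finite_structure \<sigma> P \<and> (\<forall>F\<in>\<G>. hom_to \<sigma> P (d F)) \<and>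
      (\<forall>A\<in>C. (\<forall>F\<in>\<G>. hom_to \<sigma> A (d F)) \<longrightarrow> hom_to \<sigma> A P)" if "\<G> \<subseteq> \<F>" for \<G>
  proof -
    have "finite (d ` \<G>)"
      using that fin\<F> finite_subset by blast
    moreover have "\<forall>D\<in>d ` \<G>. finite_structure \<sigma> D"
      using that d by (auto simp: is_dual_def)
    ultimately obtain P :: "(nat, 'r) rel_structure" where
      "finite_structure \<sigma> P \<and> (\<forall>D\<in>d ` \<G>. hom_to \<sigma> P D) \<and>
      (\<forall>A :: ('a, 'r) rel_structure. is_structure \<sigma> A \<longrightarrow>
         (\<forall>D\<in>d ` \<G>. hom_to \<sigma> A D) \<longrightarrow> hom_to \<sigma> A P)"
      by (rule exE[OF finite_product_exists]) (erule that)
    then show ?thesis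
      using C by (intro exI[of _ P]) (simp add: finite_structure_def)
  qed
  then obtain P :: "(nat, 'r) rel_structure set \<Rightarrow> (nat, 'r) rel_structure"
    where P: "\<And>\<G>. \<G> \<subseteq> \<F> \<Longrightarrow> finite_structure \<sigma> (P \<G>)"
    "\<And>\<G> F. \<G> \<subseteq> \<F> \<Longrightarrow> F \<in> \<G> \<Longrightarrow> hom_to \<sigma> (P \<G>) (d F)"
    "\<And>\<G> A. \<G> \<subseteq> \<F> \<Longrightarrow> A \<in> C \<Longrightarrow> \<forall>F\<in>\<G>. hom_to \<sigma> A (d F) \<Longrightarrow> hom_to \<sigma> A (P \<G>)"
    by metis
  \<comment> \<open>A crude common bound: a finite sum of naturals dominates each of its
    terms.\<close>
  define N where "N = (\<Sum>\<G>\<in>Pow \<F>. struct_order (P \<G>))"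
  have "\<exists>P :: (nat, 'r) rel_structure.
    finite_structure \<sigma> P \<and> struct_order P \<le> N \<and> hom_to \<sigma> A P \<and>
    (\<forall>F. substructure \<sigma> F P \<and> struct_order F \<le> n \<longrightarrow> hom_to \<sigma> F A)" if A: "A \<in> C" for A
  proof -
    define \<G> where "\<G> = {F \<in> \<F>. \<not> hom_to \<sigma> F A}"
    have sub: "\<G> \<subseteq> \<F>"
      by (auto simp: \<G>_def)
    have "struct_order (P \<G>) \<le> N"
      unfolding N_def using fin\<F> sub by (intro member_le_sum) auto
    \<comment> \<open>No member of \<open>\<G>\<close> maps to \<open>A\<close>, so by duality
      \<open>A\<close> maps to each factor of the product.\<close>
    moreover have "hom_to \<sigma> A (P \<G>)"
      using P(3)[OF sub A] d A by (auto simp: \<G>_def is_dual_def)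
    moreover have "hom_to \<sigma> F A" if F: "substructure \<sigma> F (P \<G>)" "struct_order F \<le> n" for F
    proof (rule hom_to_if_components[OF sig])
      show strF: "is_structure \<sigma> F"
        using F(1) by (simp add: substructure_def)
      have finF: "finite (universe F)"
        using P(1)[OF sub] F(1) by (auto simp: substructure_def finite_structure_def
            intro: finite_subset)
      fix x assume x: "x \<in> universe F"
      let ?K = "component \<sigma> F x"
      have K: "substructure \<sigma> ?K F"
        using substructure_component[OF strF] .
      have finK: "finite_structure \<sigma> ?K"
        using K finF by (auto simp: substructure_def finite_structure_def intro: finite_subset)
      have "struct_order ?K \<le> n"
        using K F(2) finF by (auto simp: substructure_def struct_order_def
            intro: order_trans[OF card_mono])
      then obtain S where S: "S \<in> structures_below \<sigma> n" "hom_to \<sigma> ?K S" "hom_to \<sigma> S ?K"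
        using hom_equivalent_below[OF finK] by blast
      have "universe ?K \<noteq> {}"
        using x by (auto simp: universe_component)
      then obtain D where "is_dual \<sigma> C ?K D"
        using dual finK connected_component[OF strF]
        unfolding all_restricted_dualities_def is_dual_def by blast
      then have SF: "S \<in> \<F>"
        using S is_dual_hom_equivalent unfolding \<F>_def by blast
      \<comment> \<open>If \<open>S\<close> were in \<open>\<G>\<close>, then composing with the
        projection from \<open>P \<G>\<close> to \<open>d S\<close> would map \<open>S\<close> to
        its own dual. So \<open>S\<close> is not in \<open>\<G>\<close>, which means that it maps to
        \<open>A\<close>.\<close>
      have "hom_to \<sigma> S (P \<G>)"
        using S(3) K F(1) by (meson substructure_hom_to hom_to_trans)
      then have "S \<notin> \<G>"
        using P(2)[OF sub] d[OF SF] unfolding is_dual_def by (meson hom_to_trans)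
      then show "hom_to \<sigma> ?K A"
        using SF S(2) hom_to_trans unfolding \<G>_def by blast
    qed
    ultimately show ?thesis
      using P(1)[OF sub] by blast
  qed
  then show ?thesis by blast
qed

text \<open>The disjoint union of the normal forms avoiding \<open>F\<close> depends only on
  \<open>F\<close> and \<open>N\<close>, so one dual serves all of \<open>C\<close>. The bound
  \<open>N\<close> ensures that each approximation avoiding \<open>F\<close> is represented among
  the summands.\<close>

lemma dual_if_approximation:
  fixes \<sigma> :: "'r signature" and C :: "('a, 'r) rel_structure set"
    and F :: "('b, 'r) rel_structure"
  assumes sig: "relational_signature \<sigma>" and fin: "finite (symbols \<sigma>)"
    and F: "finite_structure \<sigma> F" "universe F \<noteq> {}" "connected_structure \<sigma> F"
    and approx: "\<And>A. A \<in> C \<Longrightarrow> \<exists>P :: (nat, 'r) rel_structure.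
      finite_structure \<sigma> P \<and> struct_order P \<le> N \<and> hom_to \<sigma> A P \<and>
      (\<forall>G. substructure \<sigma> G P \<and> struct_order G \<le> struct_order F \<longrightarrow> hom_to \<sigma> G A)"
  shows "\<exists>D. is_dual \<sigma> C F D"
proof -
  define E where "E = {S \<in> structures_below \<sigma> N. \<not> hom_to \<sigma> F S}"
  have strF: "is_structure \<sigma> F"
    using F(1) by (simp add: finite_structure_def)
  have E: "finite E" "\<forall>S\<in>E. finite_structure \<sigma> S"
    unfolding E_def using finite_structures_below[OF fin]
    by (auto intro: structures_below_finite_structure)
  obtain D :: "(nat, 'r) rel_structure" where D: "finite_structure \<sigma> D" "\<forall>S\<in>E. hom_to \<sigma> S D"
    "\<forall>F :: ('b, 'r) rel_structure. is_structure \<sigma> F \<longrightarrow> connected_structure \<sigma> F \<longrightarrow>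
       universe F \<noteq> {} \<longrightarrow> hom_to \<sigma> F D \<longrightarrow> (\<exists>S\<in>E. hom_to \<sigma> F S)"
    using finite_disjoint_union_exists[OF sig E] by blast
  have FD: "\<not> hom_to \<sigma> F D"
    using D(3) strF F(2,3) by (auto simp: E_def)
  have "hom_to \<sigma> A D" if A: "A \<in> C" and FA: "\<not> hom_to \<sigma> F A" for A
  proof -
    obtain P :: "(nat, 'r) rel_structure" where P: "finite_structure \<sigma> P" "struct_order P \<le> N"
      "hom_to \<sigma> A P"
      "\<And>G. substructure \<sigma> G P \<Longrightarrow> struct_order G \<le> struct_order F \<Longrightarrow> hom_to \<sigma> G A"
      using approx[OF A] by blast
    \<comment> \<open>The image of \<open>F\<close> in \<open>P\<close> would be a substructure of
      order at most that of \<open>F\<close>; it would map to \<open>A\<close>, and hence so would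
      \<open>F\<close>.\<close>
    have FP: "\<not> hom_to \<sigma> F P"
    proof
      assume "hom_to \<sigma> F P"
      then obtain f where f: "\<And>x. x \<in> universe F \<Longrightarrow> f x \<in> universe P"
        "\<And>R xs. R \<in> symbols \<sigma> \<Longrightarrow> xs \<in> rel F R \<Longrightarrow> map f xs \<in> rel P R"
        unfolding hom_to_def homomorphism_def by blast
      let ?G = "image_structure \<sigma> f F"
      have "substructure \<sigma> ?G P"
        using f is_structure_image[OF strF] by (auto simp: substructure_def image_structure_def)
      moreover have "struct_order ?G \<le> struct_order F"
        using F(1) by (auto simp: struct_order_def image_structure_def finite_structure_def
            intro: card_image_le)
      ultimately show False
        using P(4) FA hom_to_image hom_to_trans by metis
    qed
    obtain S where S: "S \<in> structures_below \<sigma> N" "hom_to \<sigma> P S" "hom_to \<sigma> S P"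
      using hom_equivalent_below[OF P(1,2)] by blast
    then have "S \<in> E"
      using FP hom_to_trans unfolding E_def by blast
    then show ?thesis
      using D(2) P(3) S(2) hom_to_trans by metis
  qed
  \<comment> \<open>The other direction of duality: homomorphisms from \<open>F\<close> to
    \<open>A\<close> and from \<open>A\<close> to \<open>D\<close> would compose to one from
    \<open>F\<close> to \<open>D\<close>.\<close>
  then show ?thesis
    using D(1) FD hom_to_trans unfolding is_dual_def by blast
qed

theorem theorem9:
  fixes \<sigma> :: "'r signature" and C :: "('a, 'r) rel_structure set"
  assumes "relational_signature \<sigma>" and "finite (symbols \<sigma>)"
    and "\<forall>A\<in>C. finite_structure \<sigma> A"
  shows "bounded_class \<sigma> C \<and> all_restricted_dualities \<sigma> C \<longleftrightarrow>
    (\<forall>t::int. \<exists>N::int. \<forall>A\<in>C. \<exists>A\<^sub>t :: (nat, 'r) rel_structure.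
       finite_structure \<sigma> A\<^sub>t \<and>
       int (struct_order A\<^sub>t) \<le> N \<and>
       hom_to \<sigma> A A\<^sub>t \<and>
       (\<forall>F. substructure \<sigma> F A\<^sub>t \<and> int (struct_order F) < t \<longrightarrow> hom_to \<sigma> F A))"
    (is "?L \<longleftrightarrow> (\<forall>t. ?R t)")
proof
  assume L: ?L
  show "\<forall>t. ?R t"
  proof
    fix t
    obtain N where N: "\<forall>A\<in>C. \<exists>P :: (nat, 'r) rel_structure.
      finite_structure \<sigma> P \<and> struct_order P \<le> N \<and> hom_to \<sigma> A P \<and>
      (\<forall>F. substructure \<sigma> F P \<and> struct_order F \<le> nat t \<longrightarrow> hom_to \<sigma> F A)"
      using approximation_if_dualities[OF assms, of "nat t"] L by blast
    \<comment> \<open>Taking \<open>nat t\<close> with a weak inequality covers slightly more than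
      orders below \<open>t\<close>, and also handles negative \<open>t\<close>.\<close>
    have le: "int k < t \<Longrightarrow> k \<le> nat t" for k
      by linarith
    show "?R t"
      by (rule exI[of _ "int N"]) (use N le of_nat_le_iff in meson)
  qed
next
  assume R: "\<forall>t. ?R t"
  have "\<exists>D. is_dual \<sigma> C F D"
    if F: "finite_structure \<sigma> F" "universe F \<noteq> {}" "connected_structure \<sigma> F"
    for F :: "(nat, 'r) rel_structure"
  proof -
    \<comment> \<open>The choice of \<open>t\<close> as the order of \<open>F\<close> plus one turns
      the strict bound into order at most that of \<open>F\<close>, which is what the image of
      \<open>F\<close> satisfies.\<close>
    obtain N :: int where N: "\<forall>A\<in>C. \<exists>P :: (nat, 'r) rel_structure.
      finite_structure \<sigma> P \<and> int (struct_order P) \<le> N \<and> hom_to \<sigma> A P \<and>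
      (\<forall>G. substructure \<sigma> G P \<and> int (struct_order G) < int (struct_order F) + 1 \<longrightarrow> hom_to \<sigma> G A)"
      using R by blast
    have le: "int k \<le> N \<Longrightarrow> k \<le> nat N" "k \<le> m \<Longrightarrow> int k < int m + 1" for k m
      by linarith+
    show ?thesis
      by (rule dual_if_approximation[OF assms(1,2) F, where N = "nat N"]) (use N le in meson)
  qed
  then show ?L
    using bounded_class_trivial[OF assms(3)]
    unfolding all_restricted_dualities_def is_dual_def by blast
qed

end
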